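(* Assume that $(U_{n,m,i})_{i\ge 1}$, for positive integers $n,m$, is an array of random variables in $\mathbb{L}^2$ adapted to an array $(\mathcal{G}_{n,m,i})_{i\ge 0}$ of nested sigma fields (for each $n,m$, $\mathcal{G}_{n,m,i-1}\subseteq\mathcal{G}_{n,m,i}$ and $U_{n,m,i}$ is $\mathcal{G}_{n,m,i}$-measurable for $i\ge1$). Let $\mathbb{E}_{n,m,i}$ denote the conditional expectation with respect to $\mathcal{G}_{n,m,i}$. Suppose that $$\lim_{m\to\infty}\limsup_{n\to\infty}\mathbb{E}\Big|\sum_{i=1}^m\mathbb{E}_{n,m,i-1}(U_{n,m,i})\Big|=0,$$ that there exists $\sigma^2\ge0$ such that $$\lim_{m\to\infty}\limsup_{n\to\infty}\mathbb{E}\Big|\sum_{i=1}^m\mathrm{Var}(U_{n,m,i}|\mathcal{G}_{n,m,i-1})-\sigma^2\Big|=0,$$ and that for each $\varepsilon>0$ $$\lim_{m\to\infty}\limsup_{n\to\infty}\sum_{i=1}^m\mathbb{E}\big(U_{n,m,i}^2\mathbf{1}_{|U_{n,m,i}|>\varepsilon}\big)=0.$$ Then for any continuous and bounded function $f:\mathbb{R}\to\mathbb{R}$, $$\lim_{m\to\infty}\limsup_{n\to\infty}\Big|\mathbb{E}\Big(f\Big(\sum_{i=1}^mU_{n,m,i}\Big)\Big)-\mathbb{E}(f(\sigma N))\Big|=0,$$ where $N$ is a standard Gaussian random variable.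
   Context: For each pair $(n,m)$ the random variables are defined on a probability space, and $\mathrm{Var}(U|\mathcal{G})=\mathbb{E}(U^2|\mathcal{G})-(\mathbb{E}(U|\mathcal{G}))^2$ is the conditional variance. *)

theory Defs
  imports "HOL-Probability.Probability"
begin

definition cond_variance :: "'a measure \<Rightarrow> 'a measure \<Rightarrow> ('a \<Rightarrow> real) \<Rightarrow> 'a \<Rightarrow> real" where
  "cond_variance M G U =
     (\<lambda>x. real_cond_exp M G (\<lambda>y. (U y)\<^sup>2) x - (real_cond_exp M G U x)\<^sup>2)"

text \<open>The iterated limit of a(n, m): first limsup in n, then limit in m. The limsup is taken in the
  extended reals, so it is always defined and may be infinite for some m.\<close>

definition iterated_limsup_tendsto_0 :: "(nat \<Rightarrow> nat \<Rightarrow> real) \<Rightarrow> bool" where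
  "iterated_limsup_tendsto_0 a \<longleftrightarrow> (\<lambda>m. limsup (\<lambda>n. ereal (a n m))) \<longlonglongrightarrow> 0"

end

theory Submission
  imports Defs
begin

text \<open>
  A martingale central limit theorem under a conditional Lindeberg condition, for rows indexed by
  pairs \<open>(n, m)\<close>. The core is an explicit bound, for a single row, on the distance between the
  characteristic function of the row sum and that of \<open>N(0, \<sigma>\<^sup>2)\<close> (lemma \<open>adapted_sum_char_bound\<close>).
  Apart from factors in \<open>t\<close> and \<open>\<sigma>\<close> it involves only the three quantities that the hypotheses make
  small, namely the total drift, the deviation of the total conditional variance from
  \<open>\<sigma>\<^sup>2\<close> and the Lindeberg sum, besides the truncation level \<open>\<epsilon>\<close>.

  To obtain the bound, subtract from each summand its conditional mean. The resulting martingale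
  differences are exchanged one at a time for Gaussian factors with the same conditional
  variance (\<open>martingale_increment_char\<close>). The exchange works on the expectation of
  \<open>exp (\<i> t S\<^sub>j - t\<^sup>2 D\<^sub>j / 2)\<close>, where \<open>D\<^sub>j\<close> is the positive part of the variance not yet used up. This
  variance is known one step ahead, and cutting it off at zero keeps the integrand bounded;
  the error made by the cut telescopes (\<open>martingale_char_bound\<close>).

  If the theorem failed, one could choose pairs \<open>(n\<^sub>k, m\<^sub>k)\<close> at which the conclusion is violated by a
  fixed amount while the three quantities, the Lindeberg sum being taken at the level
  \<open>\<epsilon> = 1 / (k + 1)\<close>, are below \<open>1 / (k + 1)\<close>. The bound then gives pointwise convergence of
  the characteristic functions along this sequence, and Levy's continuity theorem a contradiction.
\<close>

section \<open>Conditional centring and truncation\<close>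

lemma cross_term_integrable:
  fixes f g :: "'a \<Rightarrow> real"
  assumes [measurable]: "f \<in> borel_measurable M" "g \<in> borel_measurable M"
    and "integrable M (\<lambda>x. (f x)\<^sup>2)" "integrable M (\<lambda>x. (g x)\<^sup>2)"
  shows "integrable M (\<lambda>x. f x * g x)"
proof (rule Bochner_Integration.integrable_bound)
  show "integrable M (\<lambda>x. (f x)\<^sup>2 + (g x)\<^sup>2)" using assms by simp
  have "\<bar>a * b\<bar> \<le> a\<^sup>2 + b\<^sup>2" for a b :: real
  proof -
    have "2 * (\<bar>a\<bar> * \<bar>b\<bar>) \<le> a\<^sup>2 + b\<^sup>2"
      using sum_squares_bound[of "\<bar>a\<bar>" "\<bar>b\<bar>"] by simp
    moreover have "0 \<le> \<bar>a\<bar> * \<bar>b\<bar>" by simp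
    ultimately show ?thesis unfolding abs_mult by linarith
  qed
  then show "AE x in M. norm (f x * g x) \<le> norm ((f x)\<^sup>2 + (g x)\<^sup>2)" by simp
qed simp

lemma square_diff_integrable:
  fixes f g :: "'a \<Rightarrow> real"
  assumes [measurable]: "f \<in> borel_measurable M" "g \<in> borel_measurable M"
    and "integrable M (\<lambda>x. (f x)\<^sup>2)" "integrable M (\<lambda>x. (g x)\<^sup>2)"
  shows "integrable M (\<lambda>x. (f x - g x)\<^sup>2)"
  unfolding power2_diff using cross_term_integrable[OF assms] assms(3,4)
  by (simp add: mult.assoc)

context finite_measure_subalgebra
begin

lemma cond_exp_square_le:
  assumes [measurable]: "U \<in> borel_measurable M" and sq: "integrable M (\<lambda>x. (U x)\<^sup>2)"
  shows "AE x in M. (real_cond_exp M F U x)\<^sup>2 \<le> real_cond_exp M F (\<lambda>y. (U y)\<^sup>2) x"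
    and "integrable M (\<lambda>x. (real_cond_exp M F U x)\<^sup>2)"
proof -
  have U: "integrable M U" using square_integrable_imp_integrable[OF assms] .
  have c: "convex_on UNIV (\<lambda>x::real. x\<^sup>2)" using convex_power2 by blast
  show le: "AE x in M. (real_cond_exp M F U x)\<^sup>2 \<le> real_cond_exp M F (\<lambda>y. (U y)\<^sup>2) x"
    by (rule real_cond_exp_jensens_inequality(2)[OF U, of UNIV]) (use sq c in auto)
  show "integrable M (\<lambda>x. (real_cond_exp M F U x)\<^sup>2)"
    by (rule Bochner_Integration.integrable_bound[OF real_cond_exp_int(1)[OF sq]])
       (use le in auto)
qed

text \<open>
  Expanding the square and pulling the measurable factor \<open>E(U|F)\<close> out of the cross term shows that
  the conditional second moment of \<open>U - E(U|F)\<close> is the conditional variance. Since the latter is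
  at most \<open>E(U\<^sup>2|F)\<close>, centring does not increase the second moment.
\<close>
lemma centred_square:
  assumes [measurable]: "U \<in> borel_measurable M" and sq: "integrable M (\<lambda>x. (U x)\<^sup>2)"
  defines "X \<equiv> \<lambda>x. U x - real_cond_exp M F U x"
  shows integrable_centred_square: "integrable M (\<lambda>x. (X x)\<^sup>2)"
    and cond_exp_centred: "AE x in M. real_cond_exp M F X x = 0"
    and cond_exp_centred_square:
      "AE x in M. real_cond_exp M F (\<lambda>y. (X y)\<^sup>2) x = cond_variance M F U x"
    and integral_centred_square_le: "(\<integral>x. (X x)\<^sup>2 \<partial>M) \<le> (\<integral>x. (U x)\<^sup>2 \<partial>M)"
proof -
  let ?e = "real_cond_exp M F U"
  have U: "integrable M U" using square_integrable_imp_integrable[OF assms(1,2)] .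
  note e2 = cond_exp_square_le(2)[OF assms(1,2)]
  have eU: "integrable M (\<lambda>x. ?e x * U x)" by (rule cross_term_integrable) (use sq e2 in auto)
  show X2: "integrable M (\<lambda>x. (X x)\<^sup>2)"
    unfolding X_def by (rule square_diff_integrable) (use sq e2 in auto)
  have ie: "integrable M ?e" using U by (rule real_cond_exp_int)
  have "AE x in M. real_cond_exp M F X x = ?e x - real_cond_exp M F ?e x"
    unfolding X_def using real_cond_exp_diff[OF U ie] .
  moreover have "AE x in M. real_cond_exp M F ?e x = ?e x"
    by (rule real_cond_exp_F_meas[OF ie]) simp
  ultimately show "AE x in M. real_cond_exp M F X x = 0" by eventually_elim simp
  have expand: "(\<lambda>y. (X y)\<^sup>2) = (\<lambda>y. ((U y)\<^sup>2 + (?e y)\<^sup>2) - 2 * (?e y * U y))"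
    by (auto simp: X_def power2_eq_square algebra_simps)
  have "AE x in M. real_cond_exp M F (\<lambda>y. (X y)\<^sup>2) x =
      real_cond_exp M F (\<lambda>y. (U y)\<^sup>2 + (?e y)\<^sup>2) x - real_cond_exp M F (\<lambda>y. 2 * (?e y * U y)) x"
    unfolding expand by (rule real_cond_exp_diff) (use sq e2 eU in auto)
  moreover have "AE x in M. real_cond_exp M F (\<lambda>y. (U y)\<^sup>2 + (?e y)\<^sup>2) x =
      real_cond_exp M F (\<lambda>y. (U y)\<^sup>2) x + real_cond_exp M F (\<lambda>y. (?e y)\<^sup>2) x"
    by (rule real_cond_exp_add) (use sq e2 in auto)
  moreover have "AE x in M. real_cond_exp M F (\<lambda>y. (?e y)\<^sup>2) x = (?e x)\<^sup>2"
    by (rule real_cond_exp_F_meas[OF e2]) simp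
  moreover have "AE x in M. real_cond_exp M F (\<lambda>y. 2 * (?e y * U y)) x =
      2 * real_cond_exp M F (\<lambda>y. ?e y * U y) x"
    by (rule real_cond_exp_cmult[OF eU])
  moreover have "AE x in M. real_cond_exp M F (\<lambda>y. ?e y * U y) x = ?e x * ?e x"
    by (rule real_cond_exp_mult) (use eU in auto)
  ultimately show cv: "AE x in M. real_cond_exp M F (\<lambda>y. (X y)\<^sup>2) x = cond_variance M F U x"
    by eventually_elim (simp add: cond_variance_def power2_eq_square)
  have "(\<integral>x. (X x)\<^sup>2 \<partial>M) = (\<integral>x. real_cond_exp M F (\<lambda>y. (X y)\<^sup>2) x \<partial>M)"
    using real_cond_exp_int(2)[OF X2] by simp
  also have "\<dots> \<le> (\<integral>x. real_cond_exp M F (\<lambda>y. (U y)\<^sup>2) x \<partial>M)"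
    by (rule integral_mono_AE)
       (use cv sq X2 in \<open>auto simp: cond_variance_def real_cond_exp_int\<close>)
  also have "\<dots> = (\<integral>x. (U x)\<^sup>2 \<partial>M)" using real_cond_exp_int(2)[OF sq] .
  finally show "(\<integral>x. (X x)\<^sup>2 \<partial>M) \<le> (\<integral>x. (U x)\<^sup>2 \<partial>M)" .
qed

lemma cond_exp_version:
  assumes f: "integrable M f" and [measurable]: "g \<in> borel_measurable M"
    and version: "AE x in M. real_cond_exp M F f x = g x"
  shows "integrable M g" and "(\<integral>x. g x \<partial>M) = (\<integral>x. f x \<partial>M)"
  using real_cond_exp_int[OF f] version integrable_cong_AE[of "real_cond_exp M F f" M g]
    integral_cong_AE[of "real_cond_exp M F f" M g] by auto

text \<open>
  Characteristic functions enter only as complex weights, determined by the past, on real variables.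
  The real and imaginary parts of such a weight reduce the claim to the defining property of
  the real conditional expectation.
\<close>
lemma cond_exp_integral_complex:
  fixes Y :: "'a \<Rightarrow> complex"
  assumes Y [measurable]: "Y \<in> borel_measurable F" and bd: "\<And>x. norm (Y x) \<le> 1"
    and f: "integrable M f"
  shows "(\<integral>x. Y x * complex_of_real (f x) \<partial>M) =
         (\<integral>x. Y x * complex_of_real (real_cond_exp M F f x) \<partial>M)"
proof -
  have YM [measurable]: "Y \<in> borel_measurable M" using measurable_from_subalg[OF subalg Y] .
  have fM [measurable]: "f \<in> borel_measurable M" using f by simp
  have int: "integrable M (\<lambda>x. Y x * complex_of_real (g x))" if g: "integrable M g" for g
  proof (rule Bochner_Integration.integrable_bound[OF g])
    have [measurable]: "g \<in> borel_measurable M" using g by simp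
    show "(\<lambda>x. Y x * complex_of_real (g x)) \<in> borel_measurable M" by measurable
    have "norm (Y x) * \<bar>g x\<bar> \<le> \<bar>g x\<bar>" for x using mult_right_mono[OF bd[of x], of "\<bar>g x\<bar>"] by simp
    then show "AE x in M. norm (Y x * complex_of_real (g x)) \<le> norm (g x)"
      by (simp add: norm_mult)
  qed
  have re: "integrable M (\<lambda>x. Re (Y x) * f x)" and im: "integrable M (\<lambda>x. Im (Y x) * f x)"
    using integrable_Re[OF int[OF f]] integrable_Im[OF int[OF f]] by simp_all
  have [measurable]: "(\<lambda>x. Re (Y x)) \<in> borel_measurable F" "(\<lambda>x. Im (Y x)) \<in> borel_measurable F"
    by measurable
  show ?thesis
  proof (rule complex_eqI)
    show "Re (\<integral>x. Y x * complex_of_real (f x) \<partial>M) =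
       Re (\<integral>x. Y x * complex_of_real (real_cond_exp M F f x) \<partial>M)"
      using real_cond_exp_intg(2)[OF re]
      by (simp add: int f real_cond_exp_int flip: integral_Re)
    show "Im (\<integral>x. Y x * complex_of_real (f x) \<partial>M) =
       Im (\<integral>x. Y x * complex_of_real (real_cond_exp M F f x) \<partial>M)"
      using real_cond_exp_intg(2)[OF im]
      by (simp add: int f real_cond_exp_int flip: integral_Im)
  qed
qed

end

text \<open>
  The large values of the centred variable: centring the truncated variable \<open>T\<close> as well keeps its second
  moment below the Lindeberg term of \<open>U\<close> at the same level \<open>\<epsilon>\<close>, while the rest is the centring of
  the variable \<open>U - T\<close>, which is bounded by \<open>\<epsilon>\<close>.
\<close>
lemma (in finite_measure_subalgebra) centred_truncation:
  fixes \<epsilon> :: real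
  assumes [measurable]: "U \<in> borel_measurable M" and sq: "integrable M (\<lambda>x. (U x)\<^sup>2)" and eps: "\<epsilon> \<ge> 0"
  defines "T \<equiv> \<lambda>x. U x * indicator {y. \<bar>U y\<bar> > \<epsilon>} x"
  shows "integrable M (\<lambda>x. (T x - real_cond_exp M F T x)\<^sup>2)"
    and "(\<integral>x. (T x - real_cond_exp M F T x)\<^sup>2 \<partial>M) \<le> (\<integral>x. (U x)\<^sup>2 * indicator {y. \<bar>U y\<bar> > \<epsilon>} x \<partial>M)"
    and "AE x in M. \<bar>(U x - real_cond_exp M F U x) - (T x - real_cond_exp M F T x)\<bar> \<le> 2 * \<epsilon>"
    and "T \<in> borel_measurable M"
proof -
  have T [measurable]: "T \<in> borel_measurable M" 
  proof -
    have "T = (\<lambda>x. if \<bar>U x\<bar> > \<epsilon> then U x else 0)" by (auto simp: T_def fun_eq_iff)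
    then show ?thesis by simp
  qed
  then show "T \<in> borel_measurable M" .
  have T2: "(\<lambda>x. (T x)\<^sup>2) = (\<lambda>x. (U x)\<^sup>2 * indicator {y. \<bar>U y\<bar> > \<epsilon>} x)"
    by (auto simp: T_def fun_eq_iff indicator_def)
  have sqT: "integrable M (\<lambda>x. (T x)\<^sup>2)"
    by (rule Bochner_Integration.integrable_bound[OF sq]) (auto simp: T_def indicator_def)
  show "integrable M (\<lambda>x. (T x - real_cond_exp M F T x)\<^sup>2)"
    by (rule integrable_centred_square[OF T sqT])
  show "(\<integral>x. (T x - real_cond_exp M F T x)\<^sup>2 \<partial>M) \<le> (\<integral>x. (U x)\<^sup>2 * indicator {y. \<bar>U y\<bar> > \<epsilon>} x \<partial>M)"
    using integral_centred_square_le[OF T sqT] unfolding T2 .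
  have U: "integrable M U" and iT: "integrable M T"
    using square_integrable_imp_integrable[OF _ sq] square_integrable_imp_integrable[OF _ sqT] by auto
  have iV: "integrable M (\<lambda>x. U x - T x)" using U iT by simp
  have V: "\<bar>U x - T x\<bar> \<le> \<epsilon>" for x using eps by (auto simp: T_def indicator_def)
  have "AE x in M. real_cond_exp M F (\<lambda>x. U x - T x) x \<le> \<epsilon>"
    by (rule real_cond_exp_le_c[OF iV]) (use V in \<open>auto simp: abs_le_iff\<close>)
  moreover have "AE x in M. real_cond_exp M F (\<lambda>x. U x - T x) x \<ge> - \<epsilon>"
    by (rule real_cond_exp_ge_c[OF iV], rule AE_I2) (use V in \<open>smt (verit) abs_le_iff\<close>)
  moreover have "AE x in M. real_cond_exp M F (\<lambda>x. U x - T x) x = real_cond_exp M F U x - real_cond_exp M F T x"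
    by (rule real_cond_exp_diff[OF U iT])
  ultimately show "AE x in M. \<bar>(U x - real_cond_exp M F U x) - (T x - real_cond_exp M F T x)\<bar> \<le> 2 * \<epsilon>"
  proof eventually_elim
    case (elim x)
    then show ?case using V[of x] by linarith
  qed
qed

section \<open>Taylor remainders\<close>

text \<open>
  The remainder is at most both \<open>\<bar>t x\<bar>\<^sup>3 / 6\<close> and \<open>(t x)\<^sup>2\<close>. Think of \<open>x\<close> as a part of size at most
  \<open>2 \<epsilon>\<close> plus a contribution \<open>b\<close> of the large values. If \<open>\<bar>b\<bar> \<le> 2 \<epsilon>\<close>, then \<open>\<bar>x\<bar> \<le> 4 \<epsilon>\<close> and the cubic
  bound gives a small multiple of \<open>x\<^sup>2\<close>; otherwise \<open>\<bar>x\<bar> \<le> 2 \<bar>b\<bar>\<close> and the quadratic bound gives a multiple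
  of \<open>b\<^sup>2\<close>.
\<close>
lemma taylor_remainder_split:
  fixes t \<epsilon> x b :: real
  assumes "\<bar>x - b\<bar> \<le> 2 * \<epsilon>"
  shows "norm (iexp (t * x) - (1 + \<i> * t * x - t\<^sup>2 * x\<^sup>2 / 2)) \<le> \<bar>t\<bar>^3 * \<epsilon> * x\<^sup>2 + 4 * t\<^sup>2 * b\<^sup>2"
proof -
  have sum: "(\<Sum>k\<le>2. (\<i> * complex_of_real (t * x))^k / fact k) = 1 + \<i> * t * x - t\<^sup>2 * x\<^sup>2 / 2"
    by (simp add: numeral_2_eq_2 fact_numeral power_mult_distrib) 
  have eps: "\<epsilon> \<ge> 0" using assms by linarith
  show ?thesis
  proof (cases "\<bar>b\<bar> \<le> 2 * \<epsilon>")
    case True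
    have "norm (iexp (t * x) - (1 + \<i> * t * x - t\<^sup>2 * x\<^sup>2 / 2)) \<le> \<bar>t * x\<bar>^3 / 6"
      using iexp_approx1[of "t * x" 2] unfolding sum by (simp add: fact_numeral eval_nat_numeral)
    also have "\<bar>x\<bar>^3 = x\<^sup>2 * \<bar>x\<bar>" by (simp add: power3_eq_cube power2_eq_square)
    then have "\<bar>t * x\<bar>^3 / 6 = \<bar>t\<bar>^3 * x\<^sup>2 * (\<bar>x\<bar> / 6)"
      by (simp add: abs_mult power_mult_distrib)
    also have "\<dots> \<le> \<bar>t\<bar>^3 * x\<^sup>2 * \<epsilon>" using True assms eps by (intro mult_left_mono) auto
    finally show ?thesis by (simp add: mult_ac add_increasing2)
  next
    case False
    have "norm (iexp (t * x) - (1 + \<i> * t * x - t\<^sup>2 * x\<^sup>2 / 2)) \<le> (t * x)\<^sup>2"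
      using iexp_approx2[of "t * x" 2] unfolding sum by (simp add: fact_numeral)
    also have "\<dots> = t\<^sup>2 * \<bar>x\<bar>\<^sup>2" by (simp add: power_mult_distrib)
    also have "\<dots> \<le> t\<^sup>2 * (2 * \<bar>b\<bar>)\<^sup>2"
      using False assms by (intro mult_left_mono power_mono) auto
    also have "\<dots> = 4 * t\<^sup>2 * b\<^sup>2" by (simp add: power_mult_distrib)
    finally show ?thesis using eps by (simp add: add_increasing)
  qed
qed

lemma square_split:
  fixes \<epsilon> x b :: real
  assumes "\<bar>x - b\<bar> \<le> 2 * \<epsilon>"
  shows "x\<^sup>2 \<le> 16 * \<epsilon>\<^sup>2 + 4 * b\<^sup>2"
proof (cases "\<bar>b\<bar> \<le> 2 * \<epsilon>")
  case True
  then have "\<bar>x\<bar>\<^sup>2 \<le> (4 * \<epsilon>)\<^sup>2" using assms by (intro power_mono) auto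
  then show ?thesis by (simp add: power_mult_distrib add_increasing2)
next
  case False
  then have "\<bar>x\<bar>\<^sup>2 \<le> (2 * \<bar>b\<bar>)\<^sup>2" using assms by (intro power_mono) auto
  then show ?thesis by (simp add: power_mult_distrib add_increasing)
qed

lemma exp_minus_le_quadratic:
  fixes x :: real
  assumes "x \<ge> 0"
  shows "exp (- x) \<le> 1 - x + x\<^sup>2 / 2"
proof -
  have "1 \<le> 1 + (x\<^sup>2)\<^sup>2 / 4" by simp
  also have "\<dots> = (1 - x + x\<^sup>2 / 2) * (1 + x + x\<^sup>2 / 2)"
    by (simp add: field_simps power2_eq_square)
  also have "\<dots> \<le> (1 - x + x\<^sup>2 / 2) * exp x"
  proof (rule mult_left_mono[OF exp_lower_Taylor_quadratic[OF assms]])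
    show "0 \<le> 1 - x + x\<^sup>2 / 2"
      using zero_le_power2[of "x - 1"] by (simp add: power2_diff)
  qed
  finally show ?thesis by (simp add: exp_minus field_simps)
qed

text \<open>
  The counterpart for the Gaussian factor, where \<open>v\<close> will be a conditional variance. It is not bounded
  by a constant, so the quadratic remainder \<open>(a v)\<^sup>2 / 2\<close> alone need not be integrable; the linear
  remainder \<open>a v\<close> takes over where the part \<open>r\<close> due to large values dominates the small part \<open>d\<close>.
\<close>
lemma exp_remainder_split:
  fixes a v r d :: real
  assumes "a \<ge> 0" "v \<ge> 0" "v \<le> d + r" "d \<ge> 0" "r \<ge> 0"
  shows "\<bar>1 - a * v - exp (- (a * v))\<bar> \<le> a\<^sup>2 * d * v + 2 * a * r"
proof -
  have av: "a * v \<ge> 0" using assms by simp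
  have lo: "1 - a * v - exp (- (a * v)) \<le> 0" using exp_ge_add_one_self[of "- (a * v)"] by simp
  show ?thesis
  proof (cases "r \<le> d")
    case True
    have "exp (-(a * v)) \<le> 1 - a * v + (a * v)\<^sup>2 / 2"
      using exp_minus_le_quadratic[OF av] .
    moreover have "(a * v)\<^sup>2 / 2 \<le> a\<^sup>2 * d * v"
    proof -
      have "v * v \<le> (2 * d) * v" using assms True by (intro mult_right_mono) auto
      then have "a\<^sup>2 * (v * v) \<le> a\<^sup>2 * ((2 * d) * v)" by (intro mult_left_mono) auto
      then show ?thesis by (simp add: power2_eq_square mult_ac)
    qed
    moreover have "2 * a * r \<ge> 0" using assms by simp
    ultimately show ?thesis using lo by simp
  next
    case False
    have "exp (-(a * v)) \<le> 1" using av by simp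
    moreover have "a * v \<le> 2 * a * r"
      using mult_left_mono[of v "2 * r" a] False assms by simp
    moreover have "a\<^sup>2 * d * v \<ge> 0" using assms by simp
    ultimately show ?thesis using lo by linarith
  qed
qed

lemma exp_minus_lipschitz:
  fixes p q :: real
  assumes "p \<ge> 0" "q \<ge> 0"
  shows "\<bar>exp (- p) - exp (- q)\<bar> \<le> \<bar>p - q\<bar>"
proof -
  have *: "exp (- p) - exp (- q) \<le> q - p" if "0 \<le> p" "p \<le> q" for p q :: real
  proof -
    have "exp (- p) - exp (- q) = exp (- p) * (1 - exp (- (q - p)))"
      by (simp add: algebra_simps flip: exp_add)
    also have "\<dots> \<le> 1 * (q - p)"
    proof (rule mult_mono)
      show "1 - exp (- (q - p)) \<le> q - p" using exp_ge_add_one_self[of "- (q - p)"] by linarith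
    qed (use that in auto)
    finally show ?thesis by simp
  qed
  show ?thesis
  proof (cases "p \<le> q")
    case True
    then have "exp (- q) \<le> exp (- p)" by simp
    then show ?thesis using *[OF assms(1) True] True by simp
  next
    case False
    then have "exp (- p) \<le> exp (- q)" by simp
    then show ?thesis using *[of q p] assms False by simp
  qed
qed

lemma norm_iexp_times_exp_minus_le_1:
  fixes r y :: real
  assumes "y \<ge> 0"
  shows "norm (iexp r * complex_of_real (exp (- y))) \<le> 1"
  using assms by (simp add: norm_mult)

lemma norm_iexp_diff_le:
  fixes x y :: real
  shows "norm (iexp x - iexp y) \<le> \<bar>x - y\<bar>"
proof -
  have "iexp x - iexp y = iexp y * (iexp (x - y) - 1)"
    by (simp add: algebra_simps flip: exp_add)
  then show ?thesis using iexp_approx1[of "x - y" 0] by (simp add: norm_mult)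
qed

section \<open>Exchanging martingale differences for Gaussian factors\<close>

text \<open>
  Given the past, the conditional characteristic function of a centred increment \<open>X\<close> with
  conditional variance \<open>v\<close> is close to that of a centred Gaussian variable with the same variance:
  both agree with \<open>1 - t\<^sup>2 v / 2\<close> up to a remainder. The weight \<open>Y\<close> is any factor that the
  past determines; integrating against it makes the linear term vanish and turns \<open>X\<^sup>2\<close> into \<open>v\<close>.
  The two remainders are controlled by splitting off a variable \<open>B\<close> that carries the large
  values of \<open>X\<close>.
\<close>
lemma (in prob_space) martingale_increment_char:
  fixes Y :: "'a \<Rightarrow> complex" and X B v :: "'a \<Rightarrow> real" and t \<epsilon> :: real
  assumes sub: "subalgebra M F"
    and Y [measurable]: "Y \<in> borel_measurable F" and bd: "\<And>x. norm (Y x) \<le> 1"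
    and X [measurable]: "X \<in> borel_measurable M" and X2: "integrable M (\<lambda>x. (X x)\<^sup>2)"
    and X0: "AE x in M. real_cond_exp M F X x = 0"
    and v [measurable]: "v \<in> borel_measurable F"
    and Xv: "AE x in M. real_cond_exp M F (\<lambda>y. (X y)\<^sup>2) x = v x"
    and B [measurable]: "B \<in> borel_measurable M" and B2: "integrable M (\<lambda>x. (B x)\<^sup>2)"
    and XB: "AE x in M. \<bar>X x - B x\<bar> \<le> 2 * \<epsilon>"
  shows "norm (\<integral>x. Y x * (iexp (t * X x) - exp (- (t\<^sup>2 / 2 * v x))) \<partial>M)
         \<le> (\<bar>t\<bar>^3 * \<epsilon> + 4 * t^4 * \<epsilon>\<^sup>2) * (\<integral>x. (X x)\<^sup>2 \<partial>M) + 8 * t\<^sup>2 * (\<integral>x. (B x)\<^sup>2 \<partial>M)"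
proof -
  interpret finite_measure_subalgebra M F by unfold_locales (rule sub)
  have YM [measurable]: "Y \<in> borel_measurable M" using measurable_from_subalg[OF sub Y] .
  have vM [measurable]: "v \<in> borel_measurable M" using measurable_from_subalg[OF sub v] .
  define a where "a = t\<^sup>2 / 2"
  have a0: "a \<ge> 0" by (simp add: a_def)
  define b where "b = real_cond_exp M F (\<lambda>y. (B y)\<^sup>2)"
  define R where "R x = iexp (t * X x) - (1 + \<i> * t * X x - t\<^sup>2 * (X x)\<^sup>2 / 2)" for x
  define Q where "Q x = 1 - a * v x - exp (- (a * v x))" for x
  have [measurable]: "R \<in> borel_measurable M" "Q \<in> borel_measurable M" "b \<in> borel_measurable M"
    unfolding R_def Q_def b_def by measurable
  have iX: "integrable M X" using square_integrable_imp_integrable[OF X X2] .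
  have ib: "integrable M b" and Eb: "integral\<^sup>L M b = (\<integral>x. (B x)\<^sup>2 \<partial>M)"
    unfolding b_def using real_cond_exp_int[OF B2] by auto
  have iv: "integrable M v" and Ev: "integral\<^sup>L M v = (\<integral>x. (X x)\<^sup>2 \<partial>M)"
    using cond_exp_version[OF X2 vM Xv] by auto
  have v0: "AE x in M. v x \<ge> 0"
    using Xv real_cond_exp_pos[of "\<lambda>y. (X y)\<^sup>2"] by auto
  have b0: "AE x in M. b x \<ge> 0" unfolding b_def by (rule real_cond_exp_pos) auto
  have vb: "AE x in M. v x \<le> 16 * \<epsilon>\<^sup>2 + 4 * b x"
  proof -
    have i4: "integrable M (\<lambda>y. 4 * (B y)\<^sup>2)" and ic: "integrable M (\<lambda>y. 16 * \<epsilon>\<^sup>2)" using B2 by auto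
    have "AE x in M. real_cond_exp M F (\<lambda>y. (X y)\<^sup>2) x
        \<le> real_cond_exp M F (\<lambda>y. 16 * \<epsilon>\<^sup>2 + 4 * (B y)\<^sup>2) x"
      by (rule real_cond_exp_mono) (use XB square_split X2 B2 in auto)
    moreover have "AE x in M. real_cond_exp M F (\<lambda>y. 16 * \<epsilon>\<^sup>2 + 4 * (B y)\<^sup>2) x =
        real_cond_exp M F (\<lambda>y. 16 * \<epsilon>\<^sup>2) x + real_cond_exp M F (\<lambda>y. 4 * (B y)\<^sup>2) x"
      by (rule real_cond_exp_add[OF ic i4])
    moreover have "AE x in M. real_cond_exp M F (\<lambda>y. 16 * \<epsilon>\<^sup>2) x = 16 * \<epsilon>\<^sup>2"
      by (rule real_cond_exp_F_meas[OF ic]) simp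
    moreover have "AE x in M. real_cond_exp M F (\<lambda>y. 4 * (B y)\<^sup>2) x = 4 * b x"
      unfolding b_def by (rule real_cond_exp_cmult[OF B2])
    ultimately show ?thesis using Xv by eventually_elim simp
  qed
  have Rle: "AE x in M. norm (R x) \<le> \<bar>t\<bar>^3 * \<epsilon> * (X x)\<^sup>2 + 4 * t\<^sup>2 * (B x)\<^sup>2"
    using XB unfolding R_def by eventually_elim (rule taylor_remainder_split)
  have Qle: "AE x in M. \<bar>Q x\<bar> \<le> a\<^sup>2 * (16 * \<epsilon>\<^sup>2) * v x + 2 * a * (4 * b x)"
    using v0 b0 vb unfolding Q_def by eventually_elim (rule exp_remainder_split[OF a0]; simp)
  have iR': "integrable M (\<lambda>x. \<bar>t\<bar>^3 * \<epsilon> * (X x)\<^sup>2 + 4 * t\<^sup>2 * (B x)\<^sup>2)" using X2 B2 by auto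
  have iQ': "integrable M (\<lambda>x. a\<^sup>2 * (16 * \<epsilon>\<^sup>2) * v x + 2 * a * (4 * b x))" using iv ib by auto
  have Ymul: "norm (Y x * z) \<le> norm z" for x z
    using mult_right_mono[OF bd[of x], of "norm z"] by (simp add: norm_mult)
  have YR: "AE x in M. norm (Y x * R x) \<le> \<bar>t\<bar>^3 * \<epsilon> * (X x)\<^sup>2 + 4 * t\<^sup>2 * (B x)\<^sup>2"
    using Rle by eventually_elim (rule order_trans[OF Ymul])
  have YQ: "AE x in M. norm (Y x * complex_of_real (Q x)) \<le> a\<^sup>2 * (16 * \<epsilon>\<^sup>2) * v x + 2 * a * (4 * b x)"
    using Qle by eventually_elim (rule order_trans[OF Ymul], simp)
  have iR: "integrable M (\<lambda>x. Y x * R x)"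
    by (rule Bochner_Integration.integrable_bound[OF iR'])
       (use YR in \<open>auto elim!: eventually_mono\<close>)
  have iQ: "integrable M (\<lambda>x. Y x * complex_of_real (Q x))"
    by (rule Bochner_Integration.integrable_bound[OF iQ'])
       (use YQ in \<open>auto elim!: eventually_mono\<close>)
  have iYc: "integrable M (\<lambda>x. Y x * complex_of_real (g x))" if g: "integrable M g" for g
    by (rule Bochner_Integration.integrable_bound[OF g])
       (use g Ymul[of _ "complex_of_real (g _)"] in auto)
  have YX: "(\<integral>x. Y x * complex_of_real (X x) \<partial>M) = 0"
  proof -
    have "(\<integral>x. Y x * complex_of_real (X x) \<partial>M) = (\<integral>x. 0 \<partial>M)"
      unfolding cond_exp_integral_complex[OF Y bd iX]
      by (rule integral_cong_AE) (use X0 in auto)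
    then show ?thesis by simp
  qed
  have YX2: "(\<integral>x. Y x * complex_of_real ((X x)\<^sup>2) \<partial>M) = (\<integral>x. Y x * complex_of_real (v x) \<partial>M)"
    unfolding cond_exp_integral_complex[OF Y bd X2]
    by (rule integral_cong_AE) (use Xv in auto)
  \<comment> \<open>The last three terms together integrate to zero by \<open>YX\<close> and \<open>YX2\<close>.\<close>
  have decomp: "Y x * (iexp (t * X x) - exp (- (a * v x))) =
      Y x * R x + Y x * complex_of_real (Q x) + \<i> * t * (Y x * complex_of_real (X x))
      - complex_of_real a * (Y x * complex_of_real ((X x)\<^sup>2)) + complex_of_real a * (Y x * complex_of_real (v x))" for x
    by (simp add: R_def Q_def a_def algebra_simps exp_of_real)
  have "(\<integral>x. Y x * (iexp (t * X x) - exp (- (a * v x))) \<partial>M) =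
      (\<integral>x. Y x * R x \<partial>M) + (\<integral>x. Y x * complex_of_real (Q x) \<partial>M)"
    unfolding decomp using iR iQ iYc[OF iX] iYc[OF X2] iYc[OF iv] YX YX2 by simp
  also have "norm \<dots> \<le> (\<integral>x. norm (Y x * R x) \<partial>M) + (\<integral>x. norm (Y x * complex_of_real (Q x)) \<partial>M)"
    by (intro norm_triangle_mono integral_norm_bound)
  also have "\<dots> \<le> (\<integral>x. \<bar>t\<bar>^3 * \<epsilon> * (X x)\<^sup>2 + 4 * t\<^sup>2 * (B x)\<^sup>2 \<partial>M)
      + (\<integral>x. a\<^sup>2 * (16 * \<epsilon>\<^sup>2) * v x + 2 * a * (4 * b x) \<partial>M)"
    by (intro add_mono integral_mono_AE integrable_norm iR iQ iR' iQ' YR YQ)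
  also have "\<dots> = (\<bar>t\<bar>^3 * \<epsilon> + 4 * t^4 * \<epsilon>\<^sup>2) * (\<integral>x. (X x)\<^sup>2 \<partial>M) + 8 * t\<^sup>2 * (\<integral>x. (B x)\<^sup>2 \<partial>M)"
    using X2 B2 iv ib by (simp add: Ev Eb a_def power_divide algebra_simps flip: power_mult)
  finally show ?thesis unfolding a_def .
qed

text \<open>
  Let \<open>S\<^sub>j\<close> and \<open>V\<^sub>j\<close> be the partial sums of the increments and of their conditional variances. The
  expectation \<open>\<Phi>\<^sub>j\<close> of \<open>exp (\<i> t S\<^sub>j - t\<^sup>2 D\<^sub>j / 2)\<close> interpolates between the Gaussian value
  \<open>exp (- t\<^sup>2 s / 2)\<close> at \<open>j = 0\<close> and almost the characteristic function of \<open>S\<^sub>m\<close> at \<open>j = m\<close>, where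
  \<open>D\<^sub>j = max 0 (s - V\<^sub>j)\<close> is the variance that is still to come. As \<open>D\<^sub>j \<ge> 0\<close>, the integrand never
  exceeds one in modulus, whatever the size of the conditional variances, so that the martingale need
  not be stopped. Each step costs the error of the previous lemma plus the growth of the overshoot
  \<open>W\<^sub>j = max 0 (V\<^sub>j - s)\<close>, because \<open>D\<^sub>j = D\<^sub>j\<^sub>+\<^sub>1 + v\<^sub>j\<^sub>+\<^sub>1 - (W\<^sub>j\<^sub>+\<^sub>1 - W\<^sub>j)\<close>. The growth telescopes,
  and the overshoot and the deficit at \<open>m\<close> add up to \<open>\<bar>V\<^sub>m - s\<bar>\<close>.
\<close>
lemma (in prob_space) martingale_char_bound:
  fixes X B v :: "nat \<Rightarrow> 'a \<Rightarrow> real" and t \<epsilon> s :: real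
  assumes sub: "\<And>i. subalgebra M (G i)"
    and nested: "\<And>i. i \<ge> 1 \<Longrightarrow> sets (G (i - 1)) \<subseteq> sets (G i)"
    and X: "\<And>i. i \<ge> 1 \<Longrightarrow> X i \<in> borel_measurable (G i)"
    and X2: "\<And>i. i \<ge> 1 \<Longrightarrow> integrable M (\<lambda>x. (X i x)\<^sup>2)"
    and X0: "\<And>i. i \<ge> 1 \<Longrightarrow> AE x in M. real_cond_exp M (G (i - 1)) (X i) x = 0"
    and v: "\<And>i. i \<ge> 1 \<Longrightarrow> v i \<in> borel_measurable (G (i - 1))"
    and Xv: "\<And>i. i \<ge> 1 \<Longrightarrow> AE x in M. real_cond_exp M (G (i - 1)) (\<lambda>y. (X i y)\<^sup>2) x = v i x"
    and B: "\<And>i. i \<ge> 1 \<Longrightarrow> B i \<in> borel_measurable M"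
    and B2: "\<And>i. i \<ge> 1 \<Longrightarrow> integrable M (\<lambda>x. (B i x)\<^sup>2)"
    and XB: "\<And>i. i \<ge> 1 \<Longrightarrow> AE x in M. \<bar>X i x - B i x\<bar> \<le> 2 * \<epsilon>"
    and s: "s \<ge> 0"
  shows "norm ((\<integral>x. iexp (t * (\<Sum>i=1..m. X i x)) \<partial>M) - exp (- (t\<^sup>2 / 2 * s)))
         \<le> t\<^sup>2 / 2 * (\<integral>x. \<bar>(\<Sum>i=1..m. v i x) - s\<bar> \<partial>M)
           + (\<bar>t\<bar>^3 * \<epsilon> + 4 * t^4 * \<epsilon>\<^sup>2) * (\<Sum>i=1..m. \<integral>x. (X i x)\<^sup>2 \<partial>M)
           + 8 * t\<^sup>2 * (\<Sum>i=1..m. \<integral>x. (B i x)\<^sup>2 \<partial>M)"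
proof -
  define a where "a = t\<^sup>2 / 2"
  have a0: "a \<ge> 0" by (simp add: a_def)
  define S where "S j x = (\<Sum>i=1..j. X i x)" for j x
  define V where "V j x = (\<Sum>i=1..j. v i x)" for j x
  define D where "D j x = max 0 (s - V j x)" for j x
  define W where "W j x = max 0 (V j x - s)" for j x
  define \<Phi> where "\<Phi> j = (\<integral>x. iexp (t * S j x) * complex_of_real (exp (- (a * D j x))) \<partial>M)" for j
  have S_Suc: "S (Suc j) x = S j x + X (Suc j) x" for j x by (simp add: S_def)
  have V_Suc: "V (Suc j) x = V j x + v (Suc j) x" for j x by (simp add: V_def)
  have D0: "D j x \<ge> 0" for j x by (simp add: D_def)
  have mono: "sets (G i) \<subseteq> sets (G j)" if "i \<le> j" for i j
    using that by (induction rule: dec_induct) (use nested[of "Suc _"] in auto)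
  have subG: "subalgebra (G j) (G i)" if "i \<le> j" for i j
    using sub[of i] sub[of j] mono[OF that] by (simp add: subalgebra_def)
  have SG: "S j \<in> borel_measurable (G j)" for j
    unfolding S_def
    by (intro borel_measurable_sum measurable_from_subalg[OF subG X]) auto
  \<comment> \<open>Predictability of the variances: the weight in step \<open>j + 1\<close> may contain \<open>V (Suc j)\<close>.\<close>
  have VG: "V (Suc j) \<in> borel_measurable (G j)" for j
    unfolding V_def
    by (intro borel_measurable_sum measurable_from_subalg[OF subG v]) auto
  have SM [measurable]: "S j \<in> borel_measurable M" for j
    using measurable_from_subalg[OF sub SG] .
  have VM [measurable]: "V j \<in> borel_measurable M" for j
    unfolding V_def
    by (intro borel_measurable_sum measurable_from_subalg[OF sub v]) auto
  have [measurable]: "D j \<in> borel_measurable M" "W j \<in> borel_measurable M" for j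
    unfolding D_def W_def by measurable
  have XM: "X i \<in> borel_measurable M" if "i \<ge> 1" for i
    using measurable_from_subalg[OF sub X[OF that]] .
  have iv: "integrable M (v i)" if i: "i \<ge> 1" for i
  proof -
    interpret finite_measure_subalgebra M "G (i - 1)" by unfold_locales (rule sub)
    have [measurable]: "v i \<in> borel_measurable M" using measurable_from_subalg[OF sub v[OF i]] .
    show ?thesis by (rule cond_exp_version(1)[OF X2[OF i] _ Xv[OF i]]) measurable
  qed
  have v0: "AE x in M. v i x \<ge> 0" if i: "i \<ge> 1" for i
  proof -
    interpret finite_measure_subalgebra M "G (i - 1)" by unfold_locales (rule sub)
    have [measurable]: "X i \<in> borel_measurable M" using XM[OF i] .
    have "AE x in M. real_cond_exp M (G (i - 1)) (\<lambda>y. (X i y)\<^sup>2) x \<ge> 0"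
      by (rule real_cond_exp_pos) auto
    then show ?thesis using Xv[OF i] by eventually_elim simp
  qed
  have iV: "integrable M (V j)" for j unfolding V_def by (intro Bochner_Integration.integrable_sum iv) auto
  have iD: "integrable M (D j)" and iW: "integrable M (W j)" for j
    unfolding D_def W_def using iV by (auto intro!: integrable_max)
  have i1: "integrable M (\<lambda>x. iexp (f x) * complex_of_real (exp (- g x)))"
    if [measurable]: "f \<in> borel_measurable M" "g \<in> borel_measurable M" and "\<And>x. g x \<ge> 0" for f g :: "'a \<Rightarrow> real"
  proof (rule Bochner_Integration.integrable_bound[of M "\<lambda>_. 1::real"])
    show "AE x in M. norm (iexp (f x) * complex_of_real (exp (- g x))) \<le> norm (1::real)"
      using norm_iexp_times_exp_minus_le_1[OF that(3)] by simp
  qed auto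

  define K where "K i = (\<bar>t\<bar>^3 * \<epsilon> + 4 * t^4 * \<epsilon>\<^sup>2) * (\<integral>x. (X i x)\<^sup>2 \<partial>M) + 8 * t\<^sup>2 * (\<integral>x. (B i x)\<^sup>2 \<partial>M)" for i
  have step: "norm (\<Phi> (Suc j) - \<Phi> j) \<le> a * ((\<integral>x. W (Suc j) x \<partial>M) - (\<integral>x. W j x \<partial>M)) + K (Suc j)" for j
  proof -
    have [measurable]: "X (Suc j) \<in> borel_measurable M" using XM by simp
    have [measurable]: "S j \<in> borel_measurable (G j)" "V (Suc j) \<in> borel_measurable (G j)"
      using SG VG by auto
    have vG: "v (Suc j) \<in> borel_measurable (G j)" using v[of "Suc j"] by simp
    have [measurable]: "v (Suc j) \<in> borel_measurable M" using measurable_from_subalg[OF sub vG] .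
    have [measurable]: "D (Suc j) \<in> borel_measurable (G j)" unfolding D_def by measurable
    define Y where "Y x = iexp (t * S j x) * complex_of_real (exp (- (a * D (Suc j) x)))" for x
    have YG: "Y \<in> borel_measurable (G j)" unfolding Y_def by measurable
    have Yb: "norm (Y x) \<le> 1" for x
      unfolding Y_def using a0 D0 by (intro norm_iexp_times_exp_minus_le_1) simp
    have YM [measurable]: "Y \<in> borel_measurable M" using measurable_from_subalg[OF sub YG] .
    \<comment> \<open>\<open>?P\<close> exchanges the increment for a Gaussian factor; \<open>?Q\<close> corrects for the truncation at zero in \<open>D\<close>.\<close>
    let ?P = "\<lambda>x. Y x * (iexp (t * X (Suc j) x) - exp (- (a * v (Suc j) x)))"
    let ?Q = "\<lambda>x. iexp (t * S j x) * complex_of_real (exp (- (a * D (Suc j) x + a * v (Suc j) x)) - exp (- (a * D j x)))"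
    have one: "norm (\<integral>x. ?P x \<partial>M) \<le> K (Suc j)"
      unfolding K_def a_def
      by (rule martingale_increment_char[OF sub YG Yb])
         (use X2[of "Suc j"] X0[of "Suc j"] vG Xv[of "Suc j"] B[of "Suc j"] B2[of "Suc j"] XB[of "Suc j"] in auto)
    have Wmono: "AE x in M. norm (?Q x) \<le> a * (W (Suc j) x - W j x)"
    proof -
      have "norm (?Q x) \<le> a * (W (Suc j) x - W j x)" if "v (Suc j) x \<ge> 0" for x
      proof -
        have "norm (?Q x) = \<bar>exp (- (a * D (Suc j) x + a * v (Suc j) x)) - exp (- (a * D j x))\<bar>"
          by (simp add: norm_mult del: of_real_diff)
        also have "\<dots> \<le> \<bar>(a * D (Suc j) x + a * v (Suc j) x) - a * D j x\<bar>"
          using a0 D0 that by (intro exp_minus_lipschitz) auto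
        also have "(a * D (Suc j) x + a * v (Suc j) x) - a * D j x = a * (W (Suc j) x - W j x)"
          unfolding D_def W_def V_Suc max_def by (auto simp: algebra_simps)
        also have "\<bar>\<dots>\<bar> = a * (W (Suc j) x - W j x)"
          using a0 that by (simp add: W_def V_Suc abs_mult)
        finally show ?thesis .
      qed
      then show ?thesis using v0[of "Suc j"] by auto
    qed
    have iWd: "integrable M (\<lambda>x. a * (W (Suc j) x - W j x))" using iW by auto
    have iQ: "integrable M ?Q"
      by (rule Bochner_Integration.integrable_bound[OF iWd])
         (use Wmono in \<open>auto elim!: eventually_mono\<close>)
    have iA: "integrable M (\<lambda>x. iexp (t * S i x) * complex_of_real (exp (- (a * D i x))))" for i
      using a0 D0 by (intro i1) auto
    have split: "iexp (t * S (Suc j) x) * complex_of_real (exp (- (a * D (Suc j) x))) -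
          iexp (t * S j x) * complex_of_real (exp (- (a * D j x))) = ?P x + ?Q x" for x
      unfolding Y_def S_Suc 
      by (simp add: algebra_simps exp_add exp_diff exp_minus divide_inverse of_real_exp)
    have iPQ: "integrable M (\<lambda>x. ?P x + ?Q x)"
      unfolding split[symmetric] by (intro Bochner_Integration.integrable_diff iA)
    have iP: "integrable M ?P"
      using Bochner_Integration.integrable_diff[OF iPQ iQ] by simp
    have "\<Phi> (Suc j) - \<Phi> j = (\<integral>x. ?P x + ?Q x \<partial>M)"
      unfolding \<Phi>_def split[symmetric] by (rule Bochner_Integration.integral_diff[symmetric]) (rule iA)+
    then have eq: "\<Phi> (Suc j) - \<Phi> j = (\<integral>x. ?P x \<partial>M) + (\<integral>x. ?Q x \<partial>M)"
      unfolding Bochner_Integration.integral_add[OF iP iQ] .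
    have "norm (\<Phi> (Suc j) - \<Phi> j) \<le> norm (\<integral>x. ?P x \<partial>M) + norm (\<integral>x. ?Q x \<partial>M)"
      unfolding eq by (rule norm_triangle_ineq)
    moreover have "norm (\<integral>x. ?Q x \<partial>M) \<le> (\<integral>x. norm (?Q x) \<partial>M)" by (rule integral_norm_bound)
    moreover have "(\<integral>x. norm (?Q x) \<partial>M) \<le> (\<integral>x. a * (W (Suc j) x - W j x) \<partial>M)"
      by (rule integral_mono_AE[OF integrable_norm[OF iQ] iWd Wmono])
    moreover have "(\<integral>x. a * (W (Suc j) x - W j x) \<partial>M) = a * ((\<integral>x. W (Suc j) x \<partial>M) - (\<integral>x. W j x \<partial>M))"
      using iW by simp
    ultimately show ?thesis using one by linarith
  qed
  have start: "\<Phi> 0 = complex_of_real (exp (- (a * s)))" and W0: "W 0 x = 0" for x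
    using s by (simp_all add: \<Phi>_def S_def D_def W_def V_def prob_space)
  have tele: "norm (\<Phi> j - \<Phi> 0) \<le> a * (\<integral>x. W j x \<partial>M) + (\<Sum>i=1..j. K i)" for j
  proof (induction j)
    case 0 show ?case by (simp add: W0)
  next
    case (Suc j)
    show ?case using norm_triangle_le[of "\<Phi> (Suc j) - \<Phi> j" "\<Phi> j - \<Phi> 0"] step[of j] Suc
      by (simp add: algebra_simps)
  qed
  have final: "norm ((\<integral>x. iexp (t * S m x) \<partial>M) - \<Phi> m) \<le> a * (\<integral>x. D m x \<partial>M)"
  proof -
    let ?R = "\<lambda>x. iexp (t * S m x) * complex_of_real (1 - exp (- (a * D m x)))"
    have ie: "integrable M (\<lambda>x. iexp (t * S m x))" using i1[of "\<lambda>x. t * S m x" "\<lambda>_. 0"] by simp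
    have iA: "integrable M (\<lambda>x. iexp (t * S m x) * complex_of_real (exp (- (a * D m x))))"
      using a0 D0 by (intro i1) auto
    have R: "iexp (t * S m x) - iexp (t * S m x) * complex_of_real (exp (- (a * D m x))) = ?R x" for x
      by (simp add: algebra_simps)
    have iR: "integrable M ?R"
      unfolding R[symmetric] by (intro Bochner_Integration.integrable_diff ie iA)
    have "(\<integral>x. iexp (t * S m x) \<partial>M) - \<Phi> m = (\<integral>x. ?R x \<partial>M)"
      unfolding \<Phi>_def R[symmetric] by (rule Bochner_Integration.integral_diff[symmetric, OF ie iA])
    also have "norm \<dots> \<le> (\<integral>x. norm (?R x) \<partial>M)" by (rule integral_norm_bound)
    also have "\<dots> \<le> (\<integral>x. a * D m x \<partial>M)"
    proof (rule integral_mono[OF integrable_norm[OF iR]])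
      show "integrable M (\<lambda>x. a * D m x)" using iD by simp
      fix x
      have "norm (?R x) = \<bar>exp (- 0) - exp (- (a * D m x))\<bar>"
        by (simp add: norm_mult del: of_real_diff)
      also have "\<dots> \<le> a * D m x"
        using exp_minus_lipschitz[of 0 "a * D m x"] a0 D0[of m x] by simp
      finally show "norm (?R x) \<le> a * D m x" .
    qed
    finally show ?thesis by simp
  qed
  have "(\<integral>x. D m x \<partial>M) + (\<integral>x. W m x \<partial>M) = (\<integral>x. \<bar>V m x - s\<bar> \<partial>M)"
    unfolding Bochner_Integration.integral_add[OF iD iW, symmetric]
    by (rule Bochner_Integration.integral_cong) (auto simp: D_def W_def)
  then have "a * (\<integral>x. D m x \<partial>M) + a * (\<integral>x. W m x \<partial>M) = a * (\<integral>x. \<bar>V m x - s\<bar> \<partial>M)"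
    by (simp flip: distrib_left)
  moreover have "norm ((\<integral>x. iexp (t * S m x) \<partial>M) - \<Phi> 0) \<le>
      a * (\<integral>x. D m x \<partial>M) + (a * (\<integral>x. W m x \<partial>M) + (\<Sum>i=1..m. K i))"
    using norm_triangle_mono[OF final tele[of m]] by simp
  ultimately show ?thesis
    unfolding start by (simp add: S_def V_def a_def K_def sum.distrib sum_distrib_left)
qed

text \<open>
  A non-asymptotic form of the theorem. The conditional means are removed from all the summands at once,
  so the drift enters only through their total over the row; the second moments of the centred
  summands add up to at most \<open>\<sigma>\<^sup>2 + \<nu>\<close>.
\<close>
lemma (in prob_space) adapted_sum_char_bound:
  fixes U :: "nat \<Rightarrow> 'a \<Rightarrow> real" and m :: nat and t \<epsilon> \<sigma> :: real
  assumes sub: "\<And>i. subalgebra M (G i)"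
    and nested: "\<And>i. i \<ge> 1 \<Longrightarrow> sets (G (i - 1)) \<subseteq> sets (G i)"
    and U: "\<And>i. i \<ge> 1 \<Longrightarrow> U i \<in> borel_measurable (G i)"
    and U2: "\<And>i. i \<ge> 1 \<Longrightarrow> integrable M (\<lambda>x. (U i x)\<^sup>2)"
    and eps: "\<epsilon> \<ge> 0"
  defines "\<mu> \<equiv> \<integral>x. \<bar>\<Sum>i=1..m. real_cond_exp M (G (i - 1)) (U i) x\<bar> \<partial>M"
    and "\<nu> \<equiv> \<integral>x. \<bar>(\<Sum>i=1..m. cond_variance M (G (i - 1)) (U i) x) - \<sigma>\<^sup>2\<bar> \<partial>M"
    and "L \<equiv> \<Sum>i=1..m. \<integral>x. (U i x)\<^sup>2 * indicator {y. \<bar>U i y\<bar> > \<epsilon>} x \<partial>M"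
  shows "norm ((\<integral>x. iexp (t * (\<Sum>i=1..m. U i x)) \<partial>M) - exp (- (t\<^sup>2 / 2 * \<sigma>\<^sup>2)))
         \<le> \<bar>t\<bar> * \<mu> + t\<^sup>2 / 2 * \<nu> + (\<bar>t\<bar>^3 * \<epsilon> + 4 * t^4 * \<epsilon>\<^sup>2) * (\<sigma>\<^sup>2 + \<nu>) + 8 * t\<^sup>2 * L"
proof -
  define e where "e i = real_cond_exp M (G (i - 1)) (U i)" for i
  define X where "X i x = U i x - e i x" for i x
  define v where "v i = cond_variance M (G (i - 1)) (U i)" for i
  define T where "T i x = U i x * indicator {y. \<bar>U i y\<bar> > \<epsilon>} x" for i x
  define B where "B i x = T i x - real_cond_exp M (G (i - 1)) (T i) x" for i x
  have UM: "U i \<in> borel_measurable M" if "i \<ge> 1" for i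
    using measurable_from_subalg[OF sub U[OF that]] .
  have eG: "e i \<in> borel_measurable (G (i - 1))" for i unfolding e_def by simp
  have vG: "v i \<in> borel_measurable (G (i - 1))" for i unfolding v_def cond_variance_def by measurable
  have eM [measurable]: "e i \<in> borel_measurable M" for i using measurable_from_subalg[OF sub eG] .
  have vM [measurable]: "v i \<in> borel_measurable M" for i using measurable_from_subalg[OF sub vG] .
  have subG: "subalgebra (G i) (G (i - 1))" if "i \<ge> 1" for i
    using sub[of i] sub[of "i - 1"] nested[OF that] by (simp add: subalgebra_def)
  have XG: "X i \<in> borel_measurable (G i)" if "i \<ge> 1" for i
    unfolding X_def using U[OF that] measurable_from_subalg[OF subG[OF that] eG]
    by (intro borel_measurable_diff)
  have XM: "X i \<in> borel_measurable M" if "i \<ge> 1" for i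
    using measurable_from_subalg[OF sub XG[OF that]] .
  have loc: "finite_measure_subalgebra M (G i)" for i by unfold_locales (rule sub)
  have cs: "integrable M (\<lambda>x. (X i x)\<^sup>2)" "AE x in M. real_cond_exp M (G (i - 1)) (X i) x = 0"
      "AE x in M. real_cond_exp M (G (i - 1)) (\<lambda>y. (X i y)\<^sup>2) x = v i x" if i: "i \<ge> 1" for i
    using finite_measure_subalgebra.centred_square(1,2,3)[OF loc[of "i - 1"] UM[OF i] U2[OF i]]
    unfolding X_def e_def v_def by auto
  have ct: "integrable M (\<lambda>x. (B i x)\<^sup>2)"
      "(\<integral>x. (B i x)\<^sup>2 \<partial>M) \<le> (\<integral>x. (U i x)\<^sup>2 * indicator {y. \<bar>U i y\<bar> > \<epsilon>} x \<partial>M)"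
      "AE x in M. \<bar>X i x - B i x\<bar> \<le> 2 * \<epsilon>" "T i \<in> borel_measurable M" if i: "i \<ge> 1" for i
    using finite_measure_subalgebra.centred_truncation[OF loc[of "i - 1"] UM[OF i] U2[OF i] eps]
    unfolding X_def B_def T_def e_def by auto
  have BM: "B i \<in> borel_measurable M" if "i \<ge> 1" for i
    unfolding B_def using ct(4)[OF that] by (intro borel_measurable_diff) auto
  have ie: "integrable M (e i)" if i: "i \<ge> 1" for i
  proof -
    interpret finite_measure_subalgebra M "G (i - 1)" by (rule loc)
    show ?thesis unfolding e_def
      by (rule real_cond_exp_int) (rule square_integrable_imp_integrable[OF UM[OF i] U2[OF i]])
  qed
  have iv: "integrable M (v i)" and Ev: "(\<integral>x. v i x \<partial>M) = (\<integral>x. (X i x)\<^sup>2 \<partial>M)" if i: "i \<ge> 1" for i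
  proof -
    interpret finite_measure_subalgebra M "G (i - 1)" by (rule loc)
    show "integrable M (v i)" "(\<integral>x. v i x \<partial>M) = (\<integral>x. (X i x)\<^sup>2 \<partial>M)"
      using cond_exp_version[OF cs(1)[OF i] vM cs(3)[OF i]] .
  qed
  have \<mu>: "\<mu> = (\<integral>x. \<bar>\<Sum>i=1..m. e i x\<bar> \<partial>M)" by (simp add: \<mu>_def e_def)
  have \<nu>: "\<nu> = (\<integral>x. \<bar>(\<Sum>i=1..m. v i x) - \<sigma>\<^sup>2\<bar> \<partial>M)" by (simp add: \<nu>_def v_def)
  have mart: "norm ((\<integral>x. iexp (t * (\<Sum>i=1..m. X i x)) \<partial>M) - exp (- (t\<^sup>2 / 2 * \<sigma>\<^sup>2)))
         \<le> t\<^sup>2 / 2 * \<nu> + (\<bar>t\<bar>^3 * \<epsilon> + 4 * t^4 * \<epsilon>\<^sup>2) * (\<Sum>i=1..m. \<integral>x. (X i x)\<^sup>2 \<partial>M)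
           + 8 * t\<^sup>2 * (\<Sum>i=1..m. \<integral>x. (B i x)\<^sup>2 \<partial>M)"
    unfolding \<nu>
    by (rule martingale_char_bound[where G = G and X = X and B = B and v = v, OF sub nested XG cs(1,2) vG cs(3) BM ct(1,3)]) auto
  have iV: "integrable M (\<lambda>x. \<Sum>i=1..m. v i x)"
    by (intro Bochner_Integration.integrable_sum iv) auto
  then have iV': "integrable M (\<lambda>x. \<bar>(\<Sum>i=1..m. v i x) - \<sigma>\<^sup>2\<bar>)"
    by (intro integrable_abs Bochner_Integration.integrable_diff) auto
  have "(\<Sum>i=1..m. \<integral>x. (X i x)\<^sup>2 \<partial>M) = (\<integral>x. (\<Sum>i=1..m. v i x) \<partial>M)"
    using iv Ev by (subst Bochner_Integration.integral_sum) auto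
  also have "\<dots> \<le> (\<integral>x. \<sigma>\<^sup>2 + \<bar>(\<Sum>i=1..m. v i x) - \<sigma>\<^sup>2\<bar> \<partial>M)"
    by (rule integral_mono[OF iV]) (use iV' in auto)
  also have "\<dots> = \<sigma>\<^sup>2 + \<nu>"
    unfolding \<nu> by (subst Bochner_Integration.integral_add[OF _ iV']) (auto simp: prob_space)
  finally have sumX: "(\<Sum>i=1..m. \<integral>x. (X i x)\<^sup>2 \<partial>M) \<le> \<sigma>\<^sup>2 + \<nu>" .
  have sumB: "(\<Sum>i=1..m. \<integral>x. (B i x)\<^sup>2 \<partial>M) \<le> L"
    unfolding L_def using ct(2) by (intro sum_mono) auto
  have ic: "integrable M (\<lambda>x. iexp (t * (\<Sum>i=1..m. f i x)))"
    if f: "\<And>i. i \<ge> 1 \<Longrightarrow> f i \<in> borel_measurable M" for f :: "nat \<Rightarrow> 'a \<Rightarrow> real"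
  proof -
    have [measurable]: "(\<lambda>x. \<Sum>i=1..m. f i x) \<in> borel_measurable M"
      by (intro borel_measurable_sum f) auto
    show ?thesis
    proof (rule Bochner_Integration.integrable_bound[of M "\<lambda>_. 1::real"])
      show "(\<lambda>x. iexp (t * (\<Sum>i=1..m. f i x))) \<in> borel_measurable M" by measurable
      show "AE x in M. norm (iexp (t * (\<Sum>i=1..m. f i x))) \<le> norm (1::real)" by simp
    qed simp
  qed
  have "(\<integral>x. iexp (t * (\<Sum>i=1..m. U i x)) \<partial>M) - (\<integral>x. iexp (t * (\<Sum>i=1..m. X i x)) \<partial>M)
      = (\<integral>x. iexp (t * (\<Sum>i=1..m. U i x)) - iexp (t * (\<Sum>i=1..m. X i x)) \<partial>M)"
    by (rule Bochner_Integration.integral_diff[symmetric]) (intro ic UM XM; assumption)+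
  also have "norm \<dots> \<le> (\<integral>x. norm (iexp (t * (\<Sum>i=1..m. U i x)) - iexp (t * (\<Sum>i=1..m. X i x))) \<partial>M)"
    by (rule integral_norm_bound)
  also have "\<dots> \<le> (\<integral>x. \<bar>t\<bar> * \<bar>\<Sum>i=1..m. e i x\<bar> \<partial>M)"
  proof (rule integral_mono)
    show "integrable M (\<lambda>x. norm (iexp (t * (\<Sum>i=1..m. U i x)) - iexp (t * (\<Sum>i=1..m. X i x))))"
      by (intro integrable_norm Bochner_Integration.integrable_diff ic UM XM)
    show "integrable M (\<lambda>x. \<bar>t\<bar> * \<bar>\<Sum>i=1..m. e i x\<bar>)"
      by (intro integrable_mult_right integrable_abs Bochner_Integration.integrable_sum ie) auto
    fix x
    have "t * (\<Sum>i=1..m. U i x) - t * (\<Sum>i=1..m. X i x) = t * (\<Sum>i=1..m. e i x)"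
      by (simp add: X_def sum_subtractf algebra_simps)
    then show "norm (iexp (t * (\<Sum>i=1..m. U i x)) - iexp (t * (\<Sum>i=1..m. X i x))) \<le> \<bar>t\<bar> * \<bar>\<Sum>i=1..m. e i x\<bar>"
      using norm_iexp_diff_le[of "t * (\<Sum>i=1..m. U i x)" "t * (\<Sum>i=1..m. X i x)"] by (simp only: abs_mult)
  qed
  also have "\<dots> = \<bar>t\<bar> * \<mu>" unfolding \<mu> by simp
  finally have drift: "norm ((\<integral>x. iexp (t * (\<Sum>i=1..m. U i x)) \<partial>M) - (\<integral>x. iexp (t * (\<Sum>i=1..m. X i x)) \<partial>M)) \<le> \<bar>t\<bar> * \<mu>" .
  have "(\<bar>t\<bar>^3 * \<epsilon> + 4 * t^4 * \<epsilon>\<^sup>2) * (\<Sum>i=1..m. \<integral>x. (X i x)\<^sup>2 \<partial>M) \<le> (\<bar>t\<bar>^3 * \<epsilon> + 4 * t^4 * \<epsilon>\<^sup>2) * (\<sigma>\<^sup>2 + \<nu>)"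
    using sumX eps by (intro mult_left_mono) auto
  moreover have "8 * t\<^sup>2 * (\<Sum>i=1..m. \<integral>x. (B i x)\<^sup>2 \<partial>M) \<le> 8 * t\<^sup>2 * L"
    using sumB by (intro mult_left_mono) auto
  ultimately show ?thesis using norm_triangle_mono[OF drift mart] by simp
qed

section \<open>Passage to the iterated limit\<close>

text \<open>
  For nonnegative arrays the iterated limit is convergence along a filter on the pairs \<open>(n, m)\<close>: any
  finitely many such smallness conditions can then be met by one and the same pair.
\<close>
lemma iterated_limsup_tendsto_0_iff:
  assumes nonneg: "\<And>n m. a n m \<ge> 0"
  shows "iterated_limsup_tendsto_0 a \<longleftrightarrow>
    (\<forall>\<delta>>0. \<forall>\<^sub>F m in sequentially. \<forall>\<^sub>F n in sequentially. a n m < \<delta>)"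
proof
  assume lim: "iterated_limsup_tendsto_0 a"
  show "\<forall>\<delta>>0. \<forall>\<^sub>F m in sequentially. \<forall>\<^sub>F n in sequentially. a n m < \<delta>"
  proof (intro allI impI)
    fix \<delta> :: real assume "\<delta> > 0"
    then have "\<forall>\<^sub>F m in sequentially. limsup (\<lambda>n. ereal (a n m)) < ereal \<delta>"
      using lim unfolding iterated_limsup_tendsto_0_def by (intro order_tendstoD(2)) auto
    then show "\<forall>\<^sub>F m in sequentially. \<forall>\<^sub>F n in sequentially. a n m < \<delta>"
      by (rule eventually_mono) (auto dest!: Limsup_lessD)
  qed
next
  assume ev: "\<forall>\<delta>>0. \<forall>\<^sub>F m in sequentially. \<forall>\<^sub>F n in sequentially. a n m < \<delta>"
  show "iterated_limsup_tendsto_0 a"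
    unfolding iterated_limsup_tendsto_0_def
  proof (rule order_tendstoI)
    fix y :: ereal assume "y < 0"
    moreover have "0 \<le> limsup (\<lambda>n. ereal (a n m))" for m
      using le_Limsup[of sequentially 0 "\<lambda>n. ereal (a n m)"] nonneg by simp
    ultimately show "\<forall>\<^sub>F m in sequentially. y < limsup (\<lambda>n. ereal (a n m))"
      using less_le_trans by (intro always_eventually) blast
  next
    fix y :: ereal assume "0 < y"
    then obtain \<delta> where \<delta>: "0 < ereal \<delta>" "ereal \<delta> < y" using ereal_dense2 by blast
    then have "\<forall>\<^sub>F m in sequentially. \<forall>\<^sub>F n in sequentially. a n m < \<delta>" using ev by auto
    then show "\<forall>\<^sub>F m in sequentially. limsup (\<lambda>n. ereal (a n m)) < y"
    proof (rule eventually_mono)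
      fix m assume "\<forall>\<^sub>F n in sequentially. a n m < \<delta>"
      then have "limsup (\<lambda>n. ereal (a n m)) \<le> ereal \<delta>"
        by (intro Limsup_bounded) (auto elim!: eventually_mono)
      then show "limsup (\<lambda>n. ereal (a n m)) < y" using \<delta> by simp
    qed
  qed
qed

lemma (in prob_space) char_scaled_std_normal:
  assumes N: "distributed M lborel N std_normal_density"
  shows "char (distr M borel (\<lambda>x. \<sigma> * N x)) t = exp (- (t\<^sup>2 / 2 * \<sigma>\<^sup>2))"
proof -
  have [measurable]: "N \<in> borel_measurable M" using distributed_measurable[OF N] by simp
  have d: "distr M borel N = std_normal_distribution"
    using distributed_distr_eq_density[OF N] by (simp cong: distr_cong)
  have "char (distr M borel (\<lambda>x. \<sigma> * N x)) t = char (distr M borel N) (t * \<sigma>)"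
    unfolding char_def by (simp add: integral_distr mult.assoc)
  also have "\<dots> = exp (- (t\<^sup>2 / 2 * \<sigma>\<^sup>2))"
    unfolding d char_std_normal_distribution by (simp add: power_mult_distrib exp_of_real)
  finally show ?thesis .
qed

theorem theorem6p1:
  fixes M :: "nat \<Rightarrow> nat \<Rightarrow> 'a measure"
    and G :: "nat \<Rightarrow> nat \<Rightarrow> nat \<Rightarrow> 'a measure"
    and U :: "nat \<Rightarrow> nat \<Rightarrow> nat \<Rightarrow> 'a \<Rightarrow> real"
    and \<sigma> :: real
    and P :: "'b measure" and N :: "'b \<Rightarrow> real"
    and f :: "real \<Rightarrow> real"
  assumes prob: "\<And>n m. n \<ge> 1 \<Longrightarrow> m \<ge> 1 \<Longrightarrow> prob_space (M n m)"
    and sub_sigma: "\<And>n m i. n \<ge> 1 \<Longrightarrow> m \<ge> 1 \<Longrightarrow> subalgebra (M n m) (G n m i)"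
    and nested: "\<And>n m i. n \<ge> 1 \<Longrightarrow> m \<ge> 1 \<Longrightarrow> i \<ge> 1 \<Longrightarrow>
                   sets (G n m (i - 1)) \<subseteq> sets (G n m i)"
    and adapted: "\<And>n m i. n \<ge> 1 \<Longrightarrow> m \<ge> 1 \<Longrightarrow> i \<ge> 1 \<Longrightarrow>
                    U n m i \<in> borel_measurable (G n m i)"
    and square_integrable: "\<And>n m i. n \<ge> 1 \<Longrightarrow> m \<ge> 1 \<Longrightarrow> i \<ge> 1 \<Longrightarrow>
                    integrable (M n m) (\<lambda>x. (U n m i x)\<^sup>2)"
    and cond_mean: "iterated_limsup_tendsto_0 (\<lambda>n m.
          \<integral>x. \<bar>\<Sum>i=1..m. real_cond_exp (M n m) (G n m (i - 1)) (U n m i) x\<bar> \<partial>M n m)"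
    and sigma_nonneg: "\<sigma> \<ge> 0"
    and cond_var: "iterated_limsup_tendsto_0 (\<lambda>n m.
          \<integral>x. \<bar>(\<Sum>i=1..m. cond_variance (M n m) (G n m (i - 1)) (U n m i) x) - \<sigma>\<^sup>2\<bar> \<partial>M n m)"
    and lindeberg: "\<And>\<epsilon>::real. \<epsilon> > 0 \<Longrightarrow> iterated_limsup_tendsto_0 (\<lambda>n m.
          \<Sum>i=1..m. \<integral>x. (U n m i x)\<^sup>2 * indicator {y. \<bar>U n m i y\<bar> > \<epsilon>} x \<partial>M n m)"
    and gauss_space: "prob_space P"
    and std_gauss: "distributed P lborel N std_normal_density"
    and f_cont: "continuous_on UNIV f"
    and f_bdd: "bounded (range f)"
  shows "iterated_limsup_tendsto_0 (\<lambda>n m.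
          \<bar>(\<integral>x. f (\<Sum>i=1..m. U n m i x) \<partial>M n m) - (\<integral>x. f (\<sigma> * N x) \<partial>P)\<bar>)"
proof -
  define \<mu> where "\<mu> n m = (\<integral>x. \<bar>\<Sum>i=1..m. real_cond_exp (M n m) (G n m (i - 1)) (U n m i) x\<bar> \<partial>M n m)" for n m
  define \<nu> where "\<nu> n m = (\<integral>x. \<bar>(\<Sum>i=1..m. cond_variance (M n m) (G n m (i - 1)) (U n m i) x) - \<sigma>\<^sup>2\<bar> \<partial>M n m)" for n m
  define L where "L \<epsilon> n m = (\<Sum>i=1..m. \<integral>x. (U n m i x)\<^sup>2 * indicator {y. \<bar>U n m i y\<bar> > \<epsilon>} x \<partial>M n m)" for \<epsilon> n m
  define a where "a n m = \<bar>(\<integral>x. f (\<Sum>i=1..m. U n m i x) \<partial>M n m) - (\<integral>x. f (\<sigma> * N x) \<partial>P)\<bar>" for n m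
  have nonneg: "\<mu> n m \<ge> 0" "\<nu> n m \<ge> 0" "L \<epsilon> n m \<ge> 0" "a n m \<ge> 0" for \<epsilon> n m
    by (auto simp: \<mu>_def \<nu>_def L_def a_def intro!: sum_nonneg integral_nonneg)
  have ev_\<mu>: "\<forall>\<^sub>F m in sequentially. \<forall>\<^sub>F n in sequentially. \<mu> n m < \<delta>" if "\<delta> > 0" for \<delta>
    using cond_mean that iterated_limsup_tendsto_0_iff[of \<mu>, OF nonneg(1)] unfolding \<mu>_def by auto
  have ev_\<nu>: "\<forall>\<^sub>F m in sequentially. \<forall>\<^sub>F n in sequentially. \<nu> n m < \<delta>" if "\<delta> > 0" for \<delta>
    using cond_var that iterated_limsup_tendsto_0_iff[of \<nu>, OF nonneg(2)] unfolding \<nu>_def by auto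
  have ev_L: "\<forall>\<^sub>F m in sequentially. \<forall>\<^sub>F n in sequentially. L \<delta> n m < \<delta>" if "\<delta> > 0" for \<delta>
    using lindeberg[OF that] that iterated_limsup_tendsto_0_iff[of "L \<delta>", OF nonneg(3)] unfolding L_def by auto
  have "iterated_limsup_tendsto_0 a"
  proof (rule ccontr)
    assume "\<not> iterated_limsup_tendsto_0 a"
    then obtain \<eta> where \<eta>: "\<eta> > 0"
      and fail: "\<not> (\<forall>\<^sub>F m in sequentially. \<forall>\<^sub>F n in sequentially. a n m < \<eta>)"
      using iterated_limsup_tendsto_0_iff[of a, OF nonneg(4)] by auto
    \<comment> \<open>The filter behind the iterated limit has no countable base, so convergence of the characteristic
      functions along it would not give weak convergence at once. A counterexample to the
      conclusion instead yields one sequence of rows along which all the hypotheses improve.\<close>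
    have "\<exists>n m. n \<ge> 1 \<and> m \<ge> 1 \<and> a n m \<ge> \<eta> \<and> \<mu> n m < \<delta> \<and> \<nu> n m < \<delta> \<and> L \<delta> n m < \<delta>"
      if \<delta>: "\<delta> > 0" for \<delta>
    proof (rule ccontr)
      assume none: "\<nexists>n m. n \<ge> 1 \<and> m \<ge> 1 \<and> a n m \<ge> \<eta> \<and> \<mu> n m < \<delta> \<and> \<nu> n m < \<delta> \<and> L \<delta> n m < \<delta>"
      have "\<forall>\<^sub>F m in sequentially. \<forall>\<^sub>F n in sequentially. a n m < \<eta>"
        using ev_\<mu>[OF \<delta>] ev_\<nu>[OF \<delta>] ev_L[OF \<delta>] eventually_ge_at_top[of 1]
      proof eventually_elim
        case (elim m)
        show ?case using elim(1,2,3) eventually_ge_at_top[of 1]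
        proof eventually_elim
          case (elim n)
          then show ?case using none \<open>1 \<le> m\<close> not_less by blast
        qed
      qed
      then show False using fail by simp
    qed
    then have "\<exists>n m. n \<ge> 1 \<and> m \<ge> 1 \<and> a n m \<ge> \<eta> \<and> \<mu> n m < inverse (Suc k) \<and> \<nu> n m < inverse (Suc k)
        \<and> L (inverse (Suc k)) n m < inverse (Suc k)" for k
      by (simp del: of_nat_Suc)
    then obtain n m where nm: "n k \<ge> 1" "m k \<ge> 1" and bad: "a (n k) (m k) \<ge> \<eta>"
      and small: "\<mu> (n k) (m k) < inverse (Suc k)" "\<nu> (n k) (m k) < inverse (Suc k)"
        "L (inverse (Suc k)) (n k) (m k) < inverse (Suc k)" for k
      by metis
    let ?M = "\<lambda>k. M (n k) (m k)"
    let ?S = "\<lambda>k x. \<Sum>i=1..m k. U (n k) (m k) i x"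
    have UM: "U (n k) (m k) i \<in> borel_measurable (?M k)" if "i \<ge> 1" for k i
      using measurable_from_subalg[OF sub_sigma adapted, OF nm nm that] .
    have SM [measurable]: "?S k \<in> borel_measurable (?M k)" for k
      by (intro borel_measurable_sum UM) auto
    have [measurable]: "N \<in> borel_measurable P" using distributed_measurable[OF std_gauss] by simp
    have NM: "(\<lambda>x. \<sigma> * N x) \<in> borel_measurable P" by measurable
    have fM [measurable]: "f \<in> borel_measurable borel"
      by (rule borel_measurable_continuous_onI[OF f_cont])
    define \<rho> where "\<rho> k = distr (?M k) borel (?S k)" for k
    define \<gamma> where "\<gamma> = distr P borel (\<lambda>x. \<sigma> * N x)"
    have \<rho>: "real_distribution (\<rho> k)" for k
      unfolding \<rho>_def by (rule prob_space.real_distribution_distr[OF prob[OF nm] SM])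
    have \<gamma>: "real_distribution \<gamma>"
      unfolding \<gamma>_def by (rule prob_space.real_distribution_distr[OF gauss_space NM])
    have inv0: "(\<lambda>k. inverse (real (Suc k))) \<longlonglongrightarrow> 0" by (rule LIMSEQ_inverse_real_of_nat)
    have char_conv: "(\<lambda>k. char (\<rho> k) t) \<longlonglongrightarrow> char \<gamma> t" for t
    proof (rule LIM_zero_cancel, rule Lim_null_comparison)
      let ?\<delta> = "\<lambda>k. inverse (real (Suc k))"
      let ?g = "\<lambda>k. \<bar>t\<bar> * ?\<delta> k + t\<^sup>2 / 2 * ?\<delta> k
          + (\<bar>t\<bar>^3 * ?\<delta> k + 4 * t^4 * (?\<delta> k)\<^sup>2) * (\<sigma>\<^sup>2 + ?\<delta> k) + 8 * t\<^sup>2 * ?\<delta> k"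
      have "?g \<longlonglongrightarrow> \<bar>t\<bar> * 0 + t\<^sup>2 / 2 * 0 + (\<bar>t\<bar>^3 * 0 + 4 * t^4 * 0\<^sup>2) * (\<sigma>\<^sup>2 + 0) + 8 * t\<^sup>2 * 0"
        by (intro tendsto_intros inv0)
      then show "?g \<longlonglongrightarrow> 0" by simp
      show "\<forall>\<^sub>F k in sequentially. norm (char (\<rho> k) t - char \<gamma> t) \<le> ?g k"
      proof (rule always_eventually, rule allI)
        fix k
        have char: "char (\<rho> k) t = (\<integral>x. iexp (t * ?S k x) \<partial>?M k)"
          unfolding \<rho>_def char_def by (rule integral_distr[OF SM]) measurable
        have gauss: "char \<gamma> t = exp (- (t\<^sup>2 / 2 * \<sigma>\<^sup>2))"
          unfolding \<gamma>_def by (rule prob_space.char_scaled_std_normal[OF gauss_space std_gauss])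
        have "norm (char (\<rho> k) t - char \<gamma> t) \<le> \<bar>t\<bar> * \<mu> (n k) (m k) + t\<^sup>2 / 2 * \<nu> (n k) (m k)
            + (\<bar>t\<bar>^3 * ?\<delta> k + 4 * t^4 * (?\<delta> k)\<^sup>2) * (\<sigma>\<^sup>2 + \<nu> (n k) (m k)) + 8 * t\<^sup>2 * L (?\<delta> k) (n k) (m k)"
          unfolding char gauss \<mu>_def \<nu>_def L_def
          by (rule prob_space.adapted_sum_char_bound[where G = "G (n k) (m k)" and U = "U (n k) (m k)",
                OF prob[OF nm(1)[of k] nm(2)[of k]]])
             (use sub_sigma nested adapted square_integrable nm in auto)
        also have "\<dots> \<le> ?g k"
          using small[of k] by (intro add_mono mult_left_mono) auto
        finally show "norm (char (\<rho> k) t - char \<gamma> t) \<le> ?g k" .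
      qed
    qed
    have weak: "weak_conv_m \<rho> \<gamma>" by (rule levy_continuity[OF \<rho> \<gamma> char_conv])
    obtain C where C: "\<And>x. norm (f x) \<le> C" using f_bdd by (auto simp: bounded_iff)
    have "(\<lambda>k. integral\<^sup>L (\<rho> k) f) \<longlonglongrightarrow> integral\<^sup>L \<gamma> f"
      by (rule weak_conv_imp_integral_bdd_continuous_conv[OF \<rho> \<gamma> weak _ C])
         (use f_cont in \<open>auto simp: continuous_on_eq_continuous_at\<close>)
    then have "(\<lambda>k. \<bar>integral\<^sup>L (\<rho> k) f - integral\<^sup>L \<gamma> f\<bar>) \<longlonglongrightarrow> 0"
      by (intro tendsto_rabs_zero LIM_zero)
    moreover have "\<bar>integral\<^sup>L (\<rho> k) f - integral\<^sup>L \<gamma> f\<bar> = a (n k) (m k)" for k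
      unfolding \<rho>_def \<gamma>_def a_def by (simp only: integral_distr[OF SM fM] integral_distr[OF NM fM])
    ultimately have "(\<lambda>k. a (n k) (m k)) \<longlonglongrightarrow> 0" by simp
    then have "\<forall>\<^sub>F k in sequentially. a (n k) (m k) < \<eta>" using \<eta> by (rule order_tendstoD(2))
    then show False using bad by (auto simp: eventually_sequentially not_less[symmetric])
  qed
  then show ?thesis unfolding a_def .
qed

end
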